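(* Let $M\subset\mathbb{R}^n$, $n\geq 2$, be a bounded Euclidean domain (closed up to its boundary) with smooth boundary $\partial M$, and let $\alpha\in(0,1)$. Let $a\in \mathcal{C}^2(M\times\mathbb{R})$ satisfy $a(x,0)=0$ for all $x\in M$ and $\partial_\mu a(x,\mu)\geq 0$ for all $(x,\mu)\in M\times\mathbb{R}$. Assume also that $$F(\mu)\leq a(x,\mu)\quad \forall\,(x,\mu)\in M\times[0,\infty),\qquad a(x,\mu)\leq F(\mu)\quad\forall\,(x,\mu)\in M\times(-\infty,0],$$ for some function $F\in\mathcal{C}^2(\mathbb{R})$ that satisfies $F(0)=0$, $F'(\mu)\geq 0$ for all $\mu\in\mathbb{R}$, and, for some constants $\delta,\epsilon>0$, $|F(\mu)|\geq \delta|\mu|^{1+\epsilon}$ for all $\mu\in\mathbb{R}$. Let $h>0$ and define $U_h=\{x\in M:\ \mathrm{dist}(x,\partial M)\geq h\}$. Then there is a constant $C_h>0$, independent of $f$, such that $$|u(x;f)|\leq C_h\qquad \forall\, x\in U_h,\ \forall\, f\in C^{2+\alpha}(\partial M),$$ where $u(\cdot;f)\in C^{2+\alpha}(M)$ is the unique solution of the boundary value problem $-\Delta u+a(x,u)=0$ in $M$, $u=f$ on $\partial M$.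
   Context: $\Delta$ is the Euclidean Laplacian. $C^{2+\alpha}$ denotes the Hölder space $C^{2,\alpha}$. Under the conditions $a(x,0)=0$ and $\partial_\mu a\geq0$, the problem $-\Delta u+a(x,u)=0$ in $M$, $u=f$ on $\partial M$ has a unique solution $u\in C^{2+\alpha}(M)$ for every $f\in C^{2+\alpha}(\partial M)$. *)

theory Defs
  imports "HOL-Analysis.Analysis"
begin

text \<open>
  The classes below are meant for sets \<^term>\<open>S\<close> contained in the closure of their interior, in
  particular for open sets and for closed-up domains.  On a closed-up domain they are the classes
  up to the boundary: the partial derivatives, which are taken in the interior, extend to
  \<^term>\<open>S\<close> with the required regularity (the function \<^term>\<open>g\<close> is the extension; it is unique on
  \<^term>\<open>S\<close>).  The values of a function outside \<^term>\<open>S\<close> are irrelevant.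
\<close>

primrec Ck_on :: "nat \<Rightarrow> 'a::euclidean_space set \<Rightarrow> ('a \<Rightarrow> 'b::real_normed_vector) \<Rightarrow> bool" where
  "Ck_on 0 S f \<longleftrightarrow> continuous_on S f"
| "Ck_on (Suc k) S f \<longleftrightarrow>
     continuous_on S f \<and> (\<forall>x\<in>interior S. f differentiable (at x)) \<and>
     (\<forall>b\<in>Basis. \<exists>g. Ck_on k S g \<and> (\<forall>x\<in>interior S. g x = frechet_derivative f (at x) b))"

definition smooth_on :: "'a::euclidean_space set \<Rightarrow> ('a \<Rightarrow> 'b::real_normed_vector) \<Rightarrow> bool" where
  "smooth_on S f \<longleftrightarrow> (\<forall>k. Ck_on k S f)"

definition holder_on :: "real \<Rightarrow> 'a::metric_space set \<Rightarrow> ('a \<Rightarrow> 'b::metric_space) \<Rightarrow> bool" where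
  "holder_on \<alpha> S f \<longleftrightarrow> (\<exists>C. \<forall>x\<in>S. \<forall>y\<in>S. dist (f x) (f y) \<le> C * dist x y powr \<alpha>)"

primrec Ck_holder_on ::
  "nat \<Rightarrow> real \<Rightarrow> 'a::euclidean_space set \<Rightarrow> ('a \<Rightarrow> 'b::real_normed_vector) \<Rightarrow> bool" where
  "Ck_holder_on 0 \<alpha> S f \<longleftrightarrow> holder_on \<alpha> S f"
| "Ck_holder_on (Suc k) \<alpha> S f \<longleftrightarrow>
     continuous_on S f \<and> (\<forall>x\<in>interior S. f differentiable (at x)) \<and>
     (\<forall>b\<in>Basis. \<exists>g. Ck_holder_on k \<alpha> S g \<and>
        (\<forall>x\<in>interior S. g x = frechet_derivative f (at x) b))"

definition laplacian :: "('a::euclidean_space \<Rightarrow> real) \<Rightarrow> 'a \<Rightarrow> real" where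
  "laplacian u x =
     (\<Sum>b\<in>Basis. frechet_derivative (\<lambda>y. frechet_derivative u (at y) b) (at x) b)"

text \<open>
  A smooth diffeomorphism \<^term>\<open>\<Phi>\<close>, with inverse \<^term>\<open>\<Psi>\<close>, of a ball around 0 onto an open
  neighbourhood of \<^term>\<open>p\<close>, under which \<^term>\<open>M\<close> corresponds to the closed half space in the
  direction of the unit vector \<^term>\<open>e\<close>, and hence the boundary of \<^term>\<open>M\<close> to the hyperplane
  orthogonal to \<^term>\<open>e\<close>.
\<close>

definition boundary_chart ::
  "'a::euclidean_space set \<Rightarrow> 'a \<Rightarrow> 'a \<Rightarrow> real \<Rightarrow> ('a \<Rightarrow> 'a) \<Rightarrow> ('a \<Rightarrow> 'a) \<Rightarrow> bool" where
  "boundary_chart M p e r \<Phi> \<Psi> \<longleftrightarrow>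
     norm e = 1 \<and> 0 < r \<and> \<Phi> 0 = p \<and> open (\<Phi> ` ball 0 r) \<and>
     homeomorphism (ball 0 r) (\<Phi> ` ball 0 r) \<Phi> \<Psi> \<and>
     smooth_on (ball 0 r) \<Phi> \<and> smooth_on (\<Phi> ` ball 0 r) \<Psi> \<and>
     M \<inter> \<Phi> ` ball 0 r = \<Phi> ` {y \<in> ball 0 r. 0 \<le> y \<bullet> e}"

definition closed_smooth_bounded_domain :: "'a::euclidean_space set \<Rightarrow> bool" where
  "closed_smooth_bounded_domain M \<longleftrightarrow>
     M \<noteq> {} \<and> bounded M \<and> M = closure (interior M) \<and> connected (interior M) \<and>
     (\<forall>p\<in>frontier M. \<exists>e r \<Phi> \<Psi>. boundary_chart M p e r \<Phi> \<Psi>)"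

text \<open>
  Functions on the boundary, regarded as a hypersurface: the local representative of \<^term>\<open>f\<close>
  is a function on a ball in the hyperplane orthogonal to \<^term>\<open>e\<close>.  Composing it with the
  orthogonal projection onto this hyperplane gives a function on a ball of the whole space that
  has the same regularity.
\<close>

definition Ck_holder_boundary ::
  "nat \<Rightarrow> real \<Rightarrow> 'a::euclidean_space set \<Rightarrow> ('a \<Rightarrow> real) \<Rightarrow> bool" where
  "Ck_holder_boundary k \<alpha> M f \<longleftrightarrow>
     (\<forall>p\<in>frontier M. \<exists>e r \<Phi> \<Psi>. boundary_chart M p e r \<Phi> \<Psi> \<and>
        Ck_holder_on k \<alpha> (ball 0 r) (\<lambda>y. f (\<Phi> (y - (y \<bullet> e) *\<^sub>R e))))"

definition dirichlet_solution ::
  "real \<Rightarrow> 'a::euclidean_space set \<Rightarrow> ('a \<Rightarrow> real \<Rightarrow> real) \<Rightarrow> ('a \<Rightarrow> real) \<Rightarrow> ('a \<Rightarrow> real) \<Rightarrow> bool" where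
  "dirichlet_solution \<alpha> M a f u \<longleftrightarrow>
     Ck_holder_on 2 \<alpha> M u \<and>
     (\<forall>x\<in>interior M. - laplacian u x + a x (u x) = 0) \<and>
     (\<forall>x\<in>frontier M. u x = f x)"

end

theory Submission
  imports Defs
begin

text \<open>
  This is the Keller--Osserman estimate with an explicit barrier.  Let \<open>x0\<close> have distance at least
  \<open>h\<close> from the boundary, put \<open>\<phi> x = h\<^sup>2 - \<bar>x - x0\<bar>\<^sup>2\<close> and \<open>p = 2 / \<epsilon>\<close>, and suppose that
  \<open>u x0 > 0\<close>.  If \<open>\<phi>\<^sup>p u\<close> attains its maximum \<open>m\<close> over the closed ball of radius \<open>h\<close> at \<open>z\<close>,
  then \<open>u\<close> is touched from above at \<open>z\<close> by \<open>m \<phi>\<^sup>-\<^sup>p\<close>, so that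
  \<open>\<delta> (m \<phi>\<^sup>-\<^sup>p)\<^sup>1\<^sup>+\<^sup>\<epsilon> \<le> \<Delta>u \<le> m \<Delta>(\<phi>\<^sup>-\<^sup>p) \<le> m K \<phi>\<^sup>-\<^sup>p\<^sup>-\<^sup>2\<close> at \<open>z\<close>.  By the choice of \<open>p\<close> the powers of
  \<open>\<phi>\<close> cancel, which leaves a bound on \<open>m\<close> and hence on \<open>u x0\<close>.  The lower bound follows by
  applying this to \<open>-u\<close>.
\<close>

lemma has_real_derivative_along_line:
  fixes f :: "'a::real_normed_vector \<Rightarrow> real"
  assumes "(f has_derivative f') (at (x + t *\<^sub>R b))"
  shows "((\<lambda>s. f (x + s *\<^sub>R b)) has_real_derivative f' b) (at t)"
proof -
  have "((\<lambda>s. x + s *\<^sub>R b) has_derivative (\<lambda>s. s *\<^sub>R b)) (at t)"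
    by (auto intro!: derivative_eq_intros)
  from has_derivative_compose[OF this assms]
  have "((\<lambda>s. f (x + s *\<^sub>R b)) has_derivative (\<lambda>s. f' (s *\<^sub>R b))) (at t)" .
  moreover have "(\<lambda>s. f' (s *\<^sub>R b)) = (*) (f' b)"
    using linear_cmul[OF has_derivative_linear[OF assms]] by (auto simp: mult.commute)
  ultimately show ?thesis
    by (simp add: has_field_derivative_def)
qed

text \<open>The first derivative vanishes at the maximum. If \<open>D\<close> were positive,
  \<open>g'\<close> would be positive just to the right of 0, and the mean value theorem would make
  \<open>g\<close> exceed \<open>g 0\<close> there.\<close>

lemma second_derivative_nonpos_at_local_max:
  fixes g g' :: "real \<Rightarrow> real"
  assumes "0 < d"
    and g: "\<And>t. \<bar>t\<bar> < d \<Longrightarrow> (g has_real_derivative g' t) (at t)"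
    and g': "(g' has_real_derivative D) (at 0)"
    and max: "\<And>t. \<bar>t\<bar> < d \<Longrightarrow> g t \<le> g 0"
  shows "D \<le> 0"
proof (rule ccontr)
  assume "\<not> D \<le> 0"
  then have "0 < D" by simp
  have "g' 0 = 0"
    using DERIV_local_max[OF g[of 0], of d] \<open>0 < d\<close> max by auto
  obtain e where "0 < e" and e: "\<And>t. 0 < t \<Longrightarrow> t < e \<Longrightarrow> g' 0 < g' (0 + t)"
    using DERIV_pos_inc_right[OF g' \<open>0 < D\<close>] by blast
  define s where "s = min d e / 2"
  have s: "0 < s" "s < d" "s < e"
    using \<open>0 < d\<close> \<open>0 < e\<close> by (auto simp: s_def)
  have "\<exists>z>0. z < s \<and> g s - g 0 = (s - 0) * g' z"
    using s by (intro MVT2 g) auto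
  then obtain z where z: "0 < z" "z < s" "g s - g 0 = s * g' z" by auto
  then have "0 < g' z" using e[of z] s \<open>g' 0 = 0\<close> by simp
  then show False using z s max[of s] by (smt (verit) mult_pos_pos)
qed

text \<open>For a unit vector \<open>b\<close>, with \<open>q\<close> the value of
  \<open>h\<^sup>2 - |x - x0|\<^sup>2\<close> at \<open>z\<close> and \<open>c\<close> the inner
  product of \<open>z - x0\<close> with \<open>b\<close>, the base
  \<open>q - 2 * t * c - t\<^sup>2\<close> is its value at the point \<open>z + t b\<close>. So
  these are the first two derivatives of the barrier along a line.\<close>

lemma barrier_derivs:
  fixes q c p t :: real
  assumes "0 < q - 2 * t * c - t\<^sup>2"
  shows "((\<lambda>t. (q - 2 * t * c - t\<^sup>2) powr (-p)) has_real_derivative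
           2 * p * (c + t) * (q - 2 * t * c - t\<^sup>2) powr (-p - 1)) (at t)" (is ?A)
    and "((\<lambda>t. 2 * p * (c + t) * (q - 2 * t * c - t\<^sup>2) powr (-p - 1)) has_real_derivative
           2 * p * (q - 2 * t * c - t\<^sup>2) powr (-p - 1)
           + 4 * p * (p + 1) * (c + t)\<^sup>2 * (q - 2 * t * c - t\<^sup>2) powr (-p - 2)) (at t)" (is ?B)
proof -
  let ?q = "\<lambda>t. q - 2 * t * c - t\<^sup>2"
  have q: "(?q has_real_derivative - 2 * (c + t)) (at t)"
    by (auto intro!: derivative_eq_intros)
  have pow: "((\<lambda>t. ?q t powr r) has_real_derivative r * ?q t powr (r - 1) * (- 2 * (c + t))) (at t)" for r
    using DERIV_fun_powr[OF q assms, of r] by simp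
  show ?A
    using pow[of "-p"] by (simp add: algebra_simps)
  have "((\<lambda>t. 2 * p * (c + t)) has_real_derivative 2 * p) (at t)"
    by (auto intro!: derivative_eq_intros)
  from DERIV_mult[OF this pow[of "-p - 1"]] show ?B
    by (simp add: algebra_simps power2_eq_square)
qed

text \<open>The differential inequality is asked for only where \<open>u\<close> is positive, and
  the derivatives enter as explicit functions, so that the lemma applies to a solution and to its
  negative alike. Derivatives live on the open ball and continuity on the closed one, because the
  sphere may touch the boundary of the domain. The bound involves neither \<open>u\<close> nor
  \<open>x0\<close>, which makes it uniform.\<close>

lemma keller_osserman_bound:
  fixes u :: "'a::euclidean_space \<Rightarrow> real"
  assumes pos: "0 < h" "0 < \<delta>" "0 < \<epsilon>"
    and cont: "continuous_on (cball x0 h) u"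
    and u1: "\<And>x. x \<in> ball x0 h \<Longrightarrow> (u has_derivative u' x) (at x)"
    and u2: "\<And>x b. x \<in> ball x0 h \<Longrightarrow> b \<in> Basis \<Longrightarrow> ((\<lambda>y. u' y b) has_derivative u'' x b) (at x)"
    and ineq: "\<And>x. x \<in> ball x0 h \<Longrightarrow> 0 < u x \<Longrightarrow> \<delta> * u x powr (1 + \<epsilon>) \<le> (\<Sum>b\<in>Basis. u'' x b b)"
  defines "p \<equiv> 2 / \<epsilon>"
  shows "u x0 \<le> (((2 * p * real DIM('a) + 4 * p * (p + 1)) * h\<^sup>2) / \<delta>) powr (1 / \<epsilon>) * (h\<^sup>2) powr (-p)"
proof (cases "u x0 \<le> 0")
  case True
  then show ?thesis by (meson mult_nonneg_nonneg order_trans powr_ge_zero)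
next
  case False
  define K where "K = (2 * p * real DIM('a) + 4 * p * (p + 1)) * h\<^sup>2"
  define \<phi> where "\<phi> x = h\<^sup>2 - (norm (x - x0))\<^sup>2" for x
  have "0 < p" using pos by (simp add: p_def)
  have \<phi>_nonneg: "0 \<le> \<phi> x" if "x \<in> cball x0 h" for x
    using that pos by (simp add: \<phi>_def dist_norm norm_minus_commute)
  have \<phi>_pos: "0 < \<phi> x" if "x \<in> ball x0 h" for x
    using that pos by (simp add: \<phi>_def dist_norm norm_minus_commute power_strict_mono)
  \<comment> \<open>On the sphere the base \<open>\<phi>\<close> vanishes; the real power stays
    continuous there because \<open>p\<close> is positive.\<close>
  have "continuous_on (cball x0 h) (\<lambda>x. \<phi> x powr p * u x)"
    using cont \<phi>_nonneg \<open>0 < p\<close> unfolding \<phi>_def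
    by (intro continuous_intros continuous_on_powr') auto
  moreover have "cball x0 h \<noteq> {}" using pos by auto
  ultimately obtain z where z: "z \<in> cball x0 h"
    and z_max: "\<And>y. y \<in> cball x0 h \<Longrightarrow> \<phi> y powr p * u y \<le> \<phi> z powr p * u z"
    using continuous_attains_sup[OF compact_cball, of x0 h "\<lambda>x. \<phi> x powr p * u x"] by blast
  define m where "m = \<phi> z powr p * u z"
  \<comment> \<open>The maximum is compared with the value at the centre, where
    \<open>\<phi>\<close> equals \<open>h\<^sup>2\<close>.\<close>
  have m_ge: "(h\<^sup>2) powr p * u x0 \<le> m"
    using z_max[of x0] pos by (simp add: m_def \<phi>_def)
  moreover have "0 < (h\<^sup>2) powr p * u x0" using False pos by simp
  ultimately have "0 < m" by linarith
  \<comment> \<open>Since \<open>0 powr p = 0\<close>, a positive maximum cannot sit on the sphere;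
    hence \<open>z\<close> is interior and second-order conditions are available there.\<close>
  then have "\<phi> z \<noteq> 0" by (auto simp: m_def)
  then have "z \<in> ball x0 h"
    using z pos by (auto simp: \<phi>_def dist_norm norm_minus_commute order_le_less)
  have "0 < \<phi> z" by (rule \<phi>_pos) fact
  have u_z: "u z = m * \<phi> z powr (-p)"
    using \<open>0 < \<phi> z\<close> by (simp add: m_def powr_minus)
  have "0 < u z" using u_z \<open>0 < m\<close> \<open>0 < \<phi> z\<close> by simp
  have u_le: "u y \<le> m * \<phi> y powr (-p)" if "y \<in> ball x0 h" for y
  proof -
    have "\<phi> y powr p * u y \<le> m"
      using that z_max[of y] by (simp add: m_def)
    then show ?thesis
      using \<phi>_pos[OF that] by (simp add: powr_minus field_simps)
  qed
  obtain d where "0 < d" and d: "ball z d \<subseteq> ball x0 h"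
    using \<open>z \<in> ball x0 h\<close> open_ball open_contains_ball by metis

  \<comment> \<open>The Laplacians are compared one coordinate direction at a time: along the line
    through \<open>z\<close> in direction \<open>b\<close>, the difference of \<open>u\<close> and
    the barrier is at most 0, with equality at \<open>z\<close>.\<close>
  have dir: "u'' z b b \<le> m * (2 * p * \<phi> z powr (-p - 1)
      + 4 * p * (p + 1) * ((z - x0) \<bullet> b)\<^sup>2 * \<phi> z powr (-p - 2))" if b: "b \<in> Basis" for b
  proof -
    define c where "c = (z - x0) \<bullet> b"
    define q where "q t = \<phi> z - 2 * t * c - t\<^sup>2" for t
    have q_eq: "\<phi> (z + t *\<^sub>R b) = q t" for t
    proof -
      have "(norm (z + t *\<^sub>R b - x0))\<^sup>2 = (norm (z - x0))\<^sup>2 + 2 * t * c + t\<^sup>2 * (b \<bullet> b)"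
        unfolding power2_norm_eq_inner
        by (simp add: c_def inner_simps algebra_simps inner_commute power2_eq_square)
      moreover have "b \<bullet> b = 1" using b by simp
      ultimately show ?thesis unfolding \<phi>_def q_def by simp
    qed
    have in_ball: "z + t *\<^sub>R b \<in> ball x0 h" if "\<bar>t\<bar> < d" for t
    proof -
      have "z + t *\<^sub>R b \<in> ball z d" using that b by (simp add: dist_norm)
      then show ?thesis using d by blast
    qed
    have q_pos: "0 < q t" if "\<bar>t\<bar> < d" for t
      using \<phi>_pos[OF in_ball[OF that]] q_eq by simp
    let ?D = "\<lambda>t. u' (z + t *\<^sub>R b) b - m * (2 * p * (c + t) * q t powr (-p - 1))"
    \<comment> \<open>The terms \<open>c + 0\<close> and \<open>q 0\<close> are left unsimplified to
      match the derivative formula for the barrier at \<open>t = 0\<close>.\<close>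
    have "u'' z b b - m * (2 * p * q 0 powr (-p - 1)
        + 4 * p * (p + 1) * (c + 0)\<^sup>2 * q 0 powr (-p - 2)) \<le> 0"
    proof (rule second_derivative_nonpos_at_local_max
        [where g = "\<lambda>t. u (z + t *\<^sub>R b) - m * q t powr (-p)" and g' = ?D])
      show "((\<lambda>t. u (z + t *\<^sub>R b) - m * q t powr (-p)) has_real_derivative ?D t) (at t)"
        if "\<bar>t\<bar> < d" for t
        using q_pos[OF that] unfolding q_def
        by (intro DERIV_diff DERIV_cmult barrier_derivs(1) has_real_derivative_along_line
            u1 in_ball that)
      have "((\<lambda>t. u' (z + t *\<^sub>R b) b) has_real_derivative u'' z b b) (at 0)"
        using u2[OF \<open>z \<in> ball x0 h\<close> b] by (intro has_real_derivative_along_line) simp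
      then show "(?D has_real_derivative u'' z b b - m * (2 * p * q 0 powr (-p - 1)
          + 4 * p * (p + 1) * (c + 0)\<^sup>2 * q 0 powr (-p - 2))) (at 0)"
        using q_pos[of 0] \<open>0 < d\<close> unfolding q_def
        by (intro DERIV_diff DERIV_cmult barrier_derivs(2)) auto
      show "u (z + t *\<^sub>R b) - m * q t powr (-p) \<le> u (z + 0 *\<^sub>R b) - m * q 0 powr (-p)"
        if "\<bar>t\<bar> < d" for t
        using u_le[OF in_ball[OF that]] u_z q_eq[of t] q_eq[of 0] by simp
    qed (use \<open>0 < d\<close> in simp)
    then show ?thesis using q_eq[of 0] by (simp add: c_def)
  qed
  have norm_le: "(norm (z - x0))\<^sup>2 \<le> h\<^sup>2"
    using \<open>0 < \<phi> z\<close> by (simp add: \<phi>_def)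
  have "\<delta> * u z powr (1 + \<epsilon>) \<le> (\<Sum>b\<in>Basis. u'' z b b)"
    using ineq \<open>z \<in> ball x0 h\<close> \<open>0 < u z\<close> by blast
  also have "\<dots> \<le> (\<Sum>b\<in>Basis. m * (2 * p * \<phi> z powr (-p - 1)
      + 4 * p * (p + 1) * ((z - x0) \<bullet> b)\<^sup>2 * \<phi> z powr (-p - 2)))"
    by (rule sum_mono) (rule dir)
  \<comment> \<open>Summing over the orthonormal basis, the constant terms produce the dimension and
    the squared coordinates of \<open>z - x0\<close> add up to its squared norm.\<close>
  also have "\<dots> = m * (2 * p * real DIM('a) * \<phi> z powr (-p - 1)
      + 4 * p * (p + 1) * (norm (z - x0))\<^sup>2 * \<phi> z powr (-p - 2))"
    unfolding norm_eq_sqrt_inner[of "z - x0"] euclidean_inner[of "z - x0" "z - x0"]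
    by (simp add: sum.distrib sum_distrib_left[symmetric] sum_distrib_right[symmetric]
        sum_nonneg power2_eq_square[symmetric] algebra_simps)
  \<comment> \<open>Both terms now share the power \<open>-p - 2\<close>. The remaining factors
    \<open>\<phi> z\<close> and \<open>(norm (z - x0))\<^sup>2\<close> are each at most
    \<open>h\<^sup>2\<close>, which is where \<open>K\<close> comes from.\<close>
  also have "\<phi> z powr (-p - 1) = \<phi> z * \<phi> z powr (-p - 2)"
    using \<open>0 < \<phi> z\<close> powr_add[of "\<phi> z" 1 "-p - 2"] by (simp add: minus_diff_commute)
  also have "m * (2 * p * real DIM('a) * (\<phi> z * \<phi> z powr (-p - 2))
      + 4 * p * (p + 1) * (norm (z - x0))\<^sup>2 * \<phi> z powr (-p - 2))
      = m * ((2 * p * real DIM('a) * \<phi> z + 4 * p * (p + 1) * (norm (z - x0))\<^sup>2) * \<phi> z powr (-p - 2))"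
    by (simp add: algebra_simps)
  also have "\<dots> \<le> m * ((2 * p * real DIM('a) * h\<^sup>2 + 4 * p * (p + 1) * h\<^sup>2) * \<phi> z powr (-p - 2))"
    using \<open>0 < m\<close> \<open>0 < p\<close> norm_le
    by (intro mult_left_mono mult_right_mono add_mono) (auto simp: \<phi>_def)
  also have "\<dots> = m * K * \<phi> z powr (-p - 2)"
    by (simp add: K_def algebra_simps)
  also have "u z powr (1 + \<epsilon>) = m * m powr \<epsilon> * \<phi> z powr (-p - 2)"
  proof -
    have "-p * (1 + \<epsilon>) = -p - 2"
      using pos by (simp add: p_def field_simps)
    then have "(\<phi> z powr (-p)) powr (1 + \<epsilon>) = \<phi> z powr (-p - 2)"
      by (simp add: powr_powr)
    then show ?thesis
      using \<open>0 < m\<close> by (simp add: u_z powr_mult powr_add)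
  qed
  finally have "(m * \<phi> z powr (-p - 2)) * (\<delta> * m powr \<epsilon>) \<le> (m * \<phi> z powr (-p - 2)) * K"
    by (simp add: algebra_simps)
  then have "m powr \<epsilon> \<le> K / \<delta>"
    using \<open>0 < m\<close> \<open>0 < \<phi> z\<close> pos by (simp add: field_simps)
  then have "(m powr \<epsilon>) powr (1 / \<epsilon>) \<le> (K / \<delta>) powr (1 / \<epsilon>)"
    using pos by (intro powr_mono2) auto
  then have "m \<le> (K / \<delta>) powr (1 / \<epsilon>)"
    using pos \<open>0 < m\<close> by (simp add: powr_powr)
  with m_ge have "u x0 * (h\<^sup>2) powr p \<le> (K / \<delta>) powr (1 / \<epsilon>)"
    by (simp add: mult.commute)
  then have "u x0 \<le> (K / \<delta>) powr (1 / \<epsilon>) * (h\<^sup>2) powr (-p)"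
    using pos by (simp add: powr_minus field_simps)
  then show ?thesis by (simp add: K_def)
qed

text \<open>The regularity class gives differentiability of an extension \<open>g\<close> of each
  partial derivative. As \<open>g\<close> agrees with the partial derivative on the open interior,
  differentiability carries over.\<close>

lemma Ck_holder_on_2_derivs:
  assumes "Ck_holder_on 2 \<alpha> S u" and "x \<in> interior S"
  shows "(u has_derivative frechet_derivative u (at x)) (at x)"
    and "b \<in> Basis \<Longrightarrow> ((\<lambda>y. frechet_derivative u (at y) b) has_derivative
           frechet_derivative (\<lambda>y. frechet_derivative u (at y) b) (at x)) (at x)"
proof -
  show "(u has_derivative frechet_derivative u (at x)) (at x)"
    using assms by (simp add: numeral_2_eq_2 frechet_derivative_works[symmetric])
  assume "b \<in> Basis"
  then obtain g where g: "g differentiable (at x)"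
    and g_eq: "\<And>y. y \<in> interior S \<Longrightarrow> g y = frechet_derivative u (at y) b"
    using assms unfolding numeral_2_eq_2 Ck_holder_on.simps by blast
  have "(g has_derivative frechet_derivative g (at x)) (at x)"
    using g by (simp add: frechet_derivative_works[symmetric])
  then have "((\<lambda>y. frechet_derivative u (at y) b) has_derivative frechet_derivative g (at x)) (at x)"
    by (rule has_derivative_transform_within_open[OF _ open_interior assms(2)]) (rule g_eq)
  then show "((\<lambda>y. frechet_derivative u (at y) b) has_derivative
      frechet_derivative (\<lambda>y. frechet_derivative u (at y) b) (at x)) (at x)"
    using frechet_derivative_works[of "\<lambda>y. frechet_derivative u (at y) b" "at x"]
      differentiableI by blast
qed

text \<open>The ball misses the frontier of \<open>M\<close> but contains the point \<open>x\<close>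
  of \<open>M\<close>. A connected set with these properties cannot leave \<open>M\<close>, and
  being open it lies in the interior.\<close>

lemma ball_subset_interior:
  fixes M :: "'a::euclidean_space set"
  assumes "x \<in> M" and "0 < h" and "h \<le> infdist x (frontier M)"
  shows "ball x h \<subseteq> interior M"
proof -
  have "ball x h \<inter> frontier M = {}"
    using assms infdist_le[of _ "frontier M" x] by (fastforce simp: not_less)
  moreover have "x \<in> ball x h \<inter> M" using assms by simp
  ultimately have "ball x h \<subseteq> M"
    using connected_Int_frontier[OF connected_ball, of x h M] by blast
  then show ?thesis by (simp add: interior_maximal)
qed

theorem theorem1p2:
  fixes M :: "(real ^ 'n) set"
    and a :: "real ^ 'n \<Rightarrow> real \<Rightarrow> real"
    and F :: "real \<Rightarrow> real"
    and \<alpha> \<delta> \<epsilon> h :: real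
  assumes "2 \<le> CARD('n)"
    and "closed_smooth_bounded_domain M"
    and "0 < \<alpha>" and "\<alpha> < 1"
    and "Ck_on 2 (M \<times> UNIV) (\<lambda>(x, \<mu>). a x \<mu>)"
    and "\<forall>x\<in>M. a x 0 = 0"
    and "\<forall>x\<in>M. \<forall>\<mu>. 0 \<le> deriv (a x) \<mu>"
    and "\<forall>x\<in>M. \<forall>\<mu>\<ge>0. F \<mu> \<le> a x \<mu>"
    and "\<forall>x\<in>M. \<forall>\<mu>\<le>0. a x \<mu> \<le> F \<mu>"
    and "Ck_on 2 UNIV F"
    and "F 0 = 0"
    and "\<forall>\<mu>. 0 \<le> deriv F \<mu>"
    and "0 < \<delta>" and "0 < \<epsilon>"
    and "\<forall>\<mu>. \<delta> * \<bar>\<mu>\<bar> powr (1 + \<epsilon>) \<le> \<bar>F \<mu>\<bar>"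
    and "0 < h"
  shows "\<exists>C>0. \<forall>f u. Ck_holder_boundary 2 \<alpha> M f \<longrightarrow> dirichlet_solution \<alpha> M a f u \<longrightarrow>
           (\<forall>x\<in>{x \<in> M. h \<le> infdist x (frontier M)}. \<bar>u x\<bar> \<le> C)"
proof -
  have F_deriv: "(F has_real_derivative deriv F \<mu>) (at \<mu>)" for \<mu>
    using assms(10) by (simp add: numeral_2_eq_2 field_differentiable_derivI
        real_differentiable_def field_differentiable_def[symmetric])
  have F_mono: "F \<mu> \<le> F \<nu>" if "\<mu> \<le> \<nu>" for \<mu> \<nu>
    using DERIV_nonneg_imp_nondecreasing[OF that] F_deriv assms(12) by blast
  \<comment> \<open>Monotonicity and \<open>F 0 = 0\<close> fix the sign of \<open>F\<close> on each
    half line, so the growth condition on its absolute value becomes one-sided.\<close>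
  have F_pos: "\<delta> * \<mu> powr (1 + \<epsilon>) \<le> F \<mu>" if "0 \<le> \<mu>" for \<mu>
    using F_mono[OF that] \<open>F 0 = 0\<close> assms(15)[rule_format, of \<mu>] that by simp
  have F_neg: "\<delta> * (- \<mu>) powr (1 + \<epsilon>) \<le> - F \<mu>" if "\<mu> \<le> 0" for \<mu>
    using F_mono[OF that] \<open>F 0 = 0\<close> assms(15)[rule_format, of \<mu>] that by simp
  have pos: "0 < h" "0 < \<delta>" "0 < \<epsilon>" by fact+
  define p where "p = 2 / \<epsilon>"
  define C where "C = (((2 * p * real DIM(real ^ 'n) + 4 * p * (p + 1)) * h\<^sup>2) / \<delta>) powr (1 / \<epsilon>)
    * (h\<^sup>2) powr (-p)"
  have "\<bar>u x0\<bar> \<le> C"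
    if sol: "dirichlet_solution \<alpha> M a f u" and x0: "x0 \<in> M" "h \<le> infdist x0 (frontier M)" for f u x0
  proof -
    define u' where "u' x = frechet_derivative u (at x)" for x
    define u'' where "u'' x b = frechet_derivative (\<lambda>y. u' y b) (at x)" for x b
    have C2: "Ck_holder_on 2 \<alpha> M u" using sol by (simp add: dirichlet_solution_def)
    have sub: "ball x0 h \<subseteq> interior M"
      using x0 \<open>0 < h\<close> by (intro ball_subset_interior)
    have "closed M"
      using assms(2) unfolding closed_smooth_bounded_domain_def by (metis closed_closure)
    \<comment> \<open>The closed ball is the closure of the open one and \<open>M\<close> is closed;
      continuity of \<open>u\<close> up to the boundary then covers the whole closed ball.\<close>
    then have "cball x0 h \<subseteq> M"
      using sub \<open>0 < h\<close> interior_subset[of M] closure_minimal[of "ball x0 h" M] by simp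
    then have cont: "continuous_on (cball x0 h) u"
      using C2 continuous_on_subset by (auto simp: numeral_2_eq_2)
    have u1: "(u has_derivative u' x) (at x)" if "x \<in> ball x0 h" for x
      unfolding u'_def using Ck_holder_on_2_derivs(1)[OF C2] sub that by blast
    have u2: "((\<lambda>y. u' y b) has_derivative u'' x b) (at x)" if "x \<in> ball x0 h" "b \<in> Basis" for x b
      unfolding u''_def u'_def using Ck_holder_on_2_derivs(2)[OF C2] sub that by blast
    have lap: "(\<Sum>b\<in>Basis. u'' x b b) = a x (u x)" and in_M: "x \<in> M" if "x \<in> ball x0 h" for x
      using sol sub that interior_subset[of M]
      by (auto simp: dirichlet_solution_def laplacian_def u''_def u'_def)
    have "u x0 \<le> C"
      unfolding C_def p_def
    proof (rule keller_osserman_bound[where u' = u' and u'' = u''])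
      fix x assume x: "x \<in> ball x0 h" "0 < u x"
      then have "F (u x) \<le> a x (u x)" using assms(8) in_M by simp
      then show "\<delta> * u x powr (1 + \<epsilon>) \<le> (\<Sum>b\<in>Basis. u'' x b b)"
        using F_pos[of "u x"] lap x by simp
    qed (use pos cont u1 u2 in auto)
    \<comment> \<open>Where \<open>- u\<close> is positive, the Laplacian of \<open>- u\<close> is
      \<open>- a x (u x)\<close>, which is at least \<open>- F (u x)\<close>; so \<open>- u\<close>
      satisfies the same differential inequality.\<close>
    moreover have "- u x0 \<le> C"
      unfolding C_def p_def
    proof (rule keller_osserman_bound
        [where u = "\<lambda>x. - u x" and u' = "\<lambda>x b. - u' x b" and u'' = "\<lambda>x b c. - u'' x b c"])
      fix x assume x: "x \<in> ball x0 h" "0 < - u x"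
      then have "a x (u x) \<le> F (u x)" using assms(9) in_M by simp
      then show "\<delta> * (- u x) powr (1 + \<epsilon>) \<le> (\<Sum>b\<in>Basis. - u'' x b b)"
        using F_neg[of "u x"] lap x by (simp add: sum_negf)
    qed (use pos cont u1 u2 in \<open>auto intro!: continuous_intros has_derivative_minus\<close>)
    ultimately show ?thesis by linarith
  qed
  moreover have "0 \<le> C" by (simp add: C_def)
  ultimately show ?thesis
    \<comment> \<open>Only \<open>0 \<le> C\<close> has been established; adding 1 gives the strict
      positivity required of the constant.\<close>
    by (intro exI[of _ "C + 1"]) (fastforce intro: order_trans)
qed

end
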